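(* Let $F:B\times[0,a]\to B\times[0,a]$, $F(\vartheta,x)=(R(\vartheta),\psi_\vartheta(x))$, be a monotone equiconcave skew product whose base map $R:B\to B$ is invertible and preserves an ergodic invariant probability measure $\mu$ on $B$. For $n\ge 0$ let $\phi_n(\vartheta)$ be the second component of $F^n(R^{-n}(\vartheta),a)$. Then the sequence $(\phi_n)_{n=0}^\infty$ is decreasing (in the weak sense), and therefore converges pointwise on the whole of $B$. Denote its limit by $\phi_K$. The graph of $\phi_K$ is invariant, and therefore the set of points at which $\phi_K$ is $0$ is also invariant. Moreover, either $\phi_K$ is $0$ $\mu$-almost everywhere, or it is positive $\mu$-almost everywhere.
   Context: Here $a>0$ and $\psi_\vartheta:[0,a]\to[0,a]$ for each $\vartheta\in B$. For $\alpha\ge 0$, a continuous real-valued function $f$ on a closed interval is $\alpha$-concave if $x\mapsto f(x)+\alpha x^2$ is concave. The system is a monotone equiconcave skew product if $\psi_\vartheta(0)=0$ and $\psi_\vartheta$ is monotone for each $\vartheta\in B$, and there is a constant $\beta>0$ such that each $\psi_\vartheta$ is $\beta\gamma_\vartheta$-concave, where $\gamma_\vartheta$ is the supremum of $\psi_\vartheta$ (so $\psi_\vartheta\equiv 0$ is allowed). Invariance of the graph of $\phi_K$ means $\psi_\vartheta(\phi_K(\vartheta))=\phi_K(R(\vartheta))$ for every $\vartheta\in B$.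
   Formalization: The almost-everywhere dichotomy is stated under the added assumption that F and the inverse of R are measurable (it fails for non-measurable fibre dependence); invariance of the zero set of the limit is meant as forward invariance under R, since identically zero fibre maps are allowed. *)

theory Defs
  imports "HOL-Probability.Probability"
begin

definition alpha_concave_on :: "real \<Rightarrow> real set \<Rightarrow> (real \<Rightarrow> real) \<Rightarrow> bool" where
  "alpha_concave_on \<alpha> S f \<longleftrightarrow>
     continuous_on S f \<and> concave_on S (\<lambda>x. f x + \<alpha> * x\<^sup>2)"

definition skew_map :: "('b \<Rightarrow> 'b) \<Rightarrow> ('b \<Rightarrow> real \<Rightarrow> real) \<Rightarrow> 'b \<times> real \<Rightarrow> 'b \<times> real" where
  "skew_map R \<psi> = (\<lambda>(\<theta>, x). (R \<theta>, \<psi> \<theta> x))"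

definition skew_product :: "'b set \<Rightarrow> real \<Rightarrow> ('b \<Rightarrow> 'b) \<Rightarrow> ('b \<Rightarrow> real \<Rightarrow> real) \<Rightarrow> bool" where
  "skew_product B a R \<psi> \<longleftrightarrow>
     R \<in> B \<rightarrow> B \<and> (\<forall>\<theta>\<in>B. \<psi> \<theta> \<in> {0..a} \<rightarrow> {0..a})"

definition monotone_equiconcave ::
  "'b set \<Rightarrow> real \<Rightarrow> ('b \<Rightarrow> 'b) \<Rightarrow> ('b \<Rightarrow> real \<Rightarrow> real) \<Rightarrow> bool" where
  "monotone_equiconcave B a R \<psi> \<longleftrightarrow>
     skew_product B a R \<psi> \<and>
     (\<forall>\<theta>\<in>B. \<psi> \<theta> 0 = 0 \<and> mono_on {0..a} (\<psi> \<theta>)) \<and>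
     (\<exists>\<beta>>0. \<forall>\<theta>\<in>B. alpha_concave_on (\<beta> * (SUP x\<in>{0..a}. \<psi> \<theta> x)) {0..a} (\<psi> \<theta>))"

definition measure_preserving_map :: "'b measure \<Rightarrow> ('b \<Rightarrow> 'b) \<Rightarrow> bool" where
  "measure_preserving_map M R \<longleftrightarrow> R \<in> measurable M M \<and> distr M M R = M"

definition ergodic_map :: "'b measure \<Rightarrow> ('b \<Rightarrow> 'b) \<Rightarrow> bool" where
  "ergodic_map M R \<longleftrightarrow>
     measure_preserving_map M R \<and>
     (\<forall>A\<in>sets M. R -` A \<inter> space M = A \<longrightarrow> measure M A = 0 \<or> measure M A = 1)"

definition phi_seq ::
  "'b set \<Rightarrow> real \<Rightarrow> ('b \<Rightarrow> 'b) \<Rightarrow> ('b \<Rightarrow> real \<Rightarrow> real) \<Rightarrow> nat \<Rightarrow> 'b \<Rightarrow> real" where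
  "phi_seq B a R \<psi> n \<theta> =
     snd ((skew_map R \<psi> ^^ n) ((the_inv_into B R ^^ n) \<theta>, a))"

definition phi_K ::
  "'b set \<Rightarrow> real \<Rightarrow> ('b \<Rightarrow> 'b) \<Rightarrow> ('b \<Rightarrow> real \<Rightarrow> real) \<Rightarrow> 'b \<Rightarrow> real" where
  "phi_K B a R \<psi> \<theta> = lim (\<lambda>n. phi_seq B a R \<psi> n \<theta>)"

definition invariant_graph ::
  "'b set \<Rightarrow> ('b \<Rightarrow> 'b) \<Rightarrow> ('b \<Rightarrow> real \<Rightarrow> real) \<Rightarrow> ('b \<Rightarrow> real) \<Rightarrow> bool" where
  "invariant_graph B R \<psi> \<phi> \<longleftrightarrow> (\<forall>\<theta>\<in>B. \<psi> \<theta> (\<phi> \<theta>) = \<phi> (R \<theta>))"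

(* Forward invariance. For the zero set of phi_K equality fails in general: a fibre map that
   vanishes identically can send a point where phi_K is positive into the zero set. *)
definition invariant_set :: "('b \<Rightarrow> 'b) \<Rightarrow> 'b set \<Rightarrow> bool" where
  "invariant_set R Z \<longleftrightarrow> R ` Z \<subseteq> Z"

(* The regularity that the almost-everywhere dichotomy needs and that monotonicity,
   convergence and invariance do not. *)
definition measurable_skew_product ::
  "'b measure \<Rightarrow> real \<Rightarrow> ('b \<Rightarrow> 'b) \<Rightarrow> ('b \<Rightarrow> real \<Rightarrow> real) \<Rightarrow> bool" where
  "measurable_skew_product M a R \<psi> \<longleftrightarrow>
     the_inv_into (space M) R \<in> measurable M M \<and>
     skew_map R \<psi> \<in> measurable (M \<Otimes>\<^sub>M restrict_space borel {0..a})
                               (M \<Otimes>\<^sub>M restrict_space borel {0..a})"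

end

theory Submission
  imports Defs
begin

text \<open>Invertibility of the base gives the cocycle identity
  \<open>\<phi>\<^sub>n\<^sub>+\<^sub>1(R \<theta>) = \<psi>\<^sub>\<theta>(\<phi>\<^sub>n(\<theta>))\<close>, so monotonicity of the fibre maps propagates
  \<open>\<phi>\<^sub>1 \<le> \<phi>\<^sub>0 = a\<close> to all \<open>n\<close>, and continuity of the fibre maps passes the identity to the
  limit.  The zero set \<open>Z\<close> of the limit is only forward invariant, but its preimages
  \<open>R\<^sup>-\<^sup>n Z\<close> increase and all have the measure of \<open>Z\<close>, while their union is strictly invariant;
  hence ergodicity applies to the union and yields the dichotomy for \<open>Z\<close>.\<close>

lemma ergodic_forward_invariant:
  assumes "prob_space M" and erg: "ergodic_map M R"
    and Z: "Z \<in> sets M" and inv: "invariant_set R Z"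
  shows "measure M Z = 0 \<or> measure M Z = 1"
proof -
  interpret prob_space M by fact
  have R: "R \<in> measurable M M" and distr: "distr M M R = M"
    using erg by (auto simp: ergodic_map_def measure_preserving_map_def)
  have Z_sub: "Z \<subseteq> space M"
    using Z by (rule sets.sets_into_space)
  define P where "P n = (R ^^ n) -` Z \<inter> space M" for n
  have P_0: "P 0 = Z"
    using Z_sub by (auto simp: P_def)
  \<comment> \<open>Splitting off the first application of \<open>R\<close> makes each
    \<open>P (Suc n)\<close> a preimage under \<open>R\<close> itself, the form in which measure
    preservation applies.\<close>
  have P_Suc: "P (Suc n) = R -` P n \<inter> space M" for n
    using measurable_space[OF R] by (auto simp: P_def funpow_swap1)
  have P_sets: "P n \<in> sets M" for n
    by (induction n) (auto simp: P_0 Z P_Suc intro!: measurable_sets[OF R])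
  have P_measure: "measure M (P n) = measure M Z" for n
  proof (induction n)
    case (Suc n)
    have "measure M (P (Suc n)) = measure (distr M M R) (P n)"
      using P_sets by (simp add: P_Suc measure_distr[OF R])
    with Suc show ?case by (simp add: distr)
  qed (simp add: P_0)
  \<comment> \<open>Here the last application of \<open>R\<close> is split off instead: an orbit
    that is in \<open>Z\<close> at time \<open>n\<close> stays there.\<close>
  have "P n \<subseteq> P (Suc n)" for n
    using inv by (auto simp: P_def invariant_set_def)
  then have P_inc: "incseq P"
    by (rule incseq_SucI)
  have "(\<lambda>n. measure M (P n)) \<longlonglongrightarrow> measure M (\<Union>n. P n)"
    using P_sets P_inc by (intro finite_Lim_measure_incseq) auto
  then have union: "measure M (\<Union>n. P n) = measure M Z"
    by (simp add: P_measure LIMSEQ_const_iff)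
  \<comment> \<open>Taking the preimage only shifts the index. The lost set \<open>P 0\<close> lies
    in \<open>P 1\<close>, so the union equals its own preimage, as \<open>ergodic_map\<close>
    demands.\<close>
  have "R -` (\<Union>n. P n) \<inter> space M = (\<Union>n. P (Suc n))"
    by (auto simp: P_Suc)
  also have "\<dots> = (\<Union>n. P n)"
    using \<open>\<And>n. P n \<subseteq> P (Suc n)\<close> by blast
  finally have "measure M (\<Union>n. P n) = 0 \<or> measure M (\<Union>n. P n) = 1"
    using erg sets.countable_nat_UN[of P M] P_sets by (auto simp: ergodic_map_def)
  then show ?thesis
    by (simp add: union)
qed

lemma fst_skew_map_funpow: "fst ((skew_map R \<psi> ^^ n) p) = (R ^^ n) (fst p)"
  by (induction n) (simp_all add: skew_map_def case_prod_beta)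

lemma snd_skew_map: "snd (skew_map R \<psi> p) = \<psi> (fst p) (snd p)"
  by (simp add: skew_map_def case_prod_beta)

lemma funpow_the_inv_into:
  assumes "bij_betw R B B" "\<theta> \<in> B"
  shows "(R ^^ n) ((the_inv_into B R ^^ n) \<theta>) = \<theta>"
  using assms(2)
proof (induction n arbitrary: \<theta>)
  case (Suc n)
  \<comment> \<open>The induction hypothesis is used at this point: the inner \<open>n\<close> pairs
    cancel there, and one \<open>R\<close> is left to undo one inverse.\<close>
  have "(the_inv_into B R) \<theta> \<in> B"
    using bij_betw_the_inv_into[OF assms(1)] Suc.prems by (auto simp: bij_betw_def)
  then show ?case
    using Suc.IH Suc.prems assms(1) by (simp add: funpow_swap1[of "the_inv_into B R"] f_the_inv_into_f_bij_betw)
qed simp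

lemma phi_seq_0 [simp]: "phi_seq B a R \<psi> 0 \<theta> = a"
  by (simp add: phi_seq_def)

text \<open>Going back \<open>n + 1\<close> steps from \<open>R \<theta>\<close> reaches the same
  base point as going back \<open>n\<close> steps from \<open>\<theta>\<close>. Forward from there,
  \<open>n\<close> steps return to \<open>\<theta>\<close>, and the last step applies
  \<open>\<psi> \<theta>\<close>. Since \<open>R\<close> is onto, points \<open>R \<theta>\<close>
  exhaust the base.\<close>

lemma phi_seq_Suc:
  assumes "bij_betw R B B" "\<theta> \<in> B"
  shows "phi_seq B a R \<psi> (Suc n) (R \<theta>) = \<psi> \<theta> (phi_seq B a R \<psi> n \<theta>)"
proof -
  have inv: "the_inv_into B R (R \<theta>) = \<theta>"
    using assms by (simp add: the_inv_into_f_f bij_betw_def)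
  have "(the_inv_into B R ^^ Suc n) (R \<theta>) = (the_inv_into B R ^^ n) \<theta>"
    by (simp only: funpow_Suc_right o_apply inv)
  \<comment> \<open>Only the iterate of the skew map is unfolded; that of the inverse must keep the
    shape of the equation just proved.\<close>
  then show ?thesis
    by (simp add: phi_seq_def snd_skew_map fst_skew_map_funpow funpow_the_inv_into[OF assms]
        del: funpow.simps(2) add: funpow.simps(2)[of n "skew_map R \<psi>"])
qed

text \<open>Keeps the iterates where monotonicity and continuity of the fibre maps are
  available.\<close>

lemma phi_seq_mem:
  assumes "a > 0" and sp: "skew_product B a R \<psi>" and bij: "bij_betw R B B" and "\<theta> \<in> B"
  shows "phi_seq B a R \<psi> n \<theta> \<in> {0..a}"
  using \<open>\<theta> \<in> B\<close>
proof (induction n arbitrary: \<theta>)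
  case (Suc n)
  then obtain \<eta> where "\<eta> \<in> B" "\<theta> = R \<eta>"
    using bij by (auto simp: bij_betw_def)
  then show ?case
    using funcset_mem[OF _ Suc.IH[of \<eta>], of "\<psi> \<eta>" "{0..a}"] sp
    by (simp add: phi_seq_Suc[OF bij] skew_product_def)
qed (use \<open>a > 0\<close> in simp)

lemma phi_seq_decseq:
  assumes "a > 0" and sp: "skew_product B a R \<psi>" and bij: "bij_betw R B B"
    and mono: "\<forall>\<theta>\<in>B. mono_on {0..a} (\<psi> \<theta>)" and "\<theta> \<in> B"
  shows "decseq (\<lambda>n. phi_seq B a R \<psi> n \<theta>)"
proof (rule decseq_SucI)
  note mem = phi_seq_mem[OF \<open>a > 0\<close> sp bij]
  fix n
  show "phi_seq B a R \<psi> (Suc n) \<theta> \<le> phi_seq B a R \<psi> n \<theta>"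
    using \<open>\<theta> \<in> B\<close>
  proof (induction n arbitrary: \<theta>)
    case 0
    then show ?case using mem[of \<theta> 1] by simp
  next
    case (Suc n)
    \<comment> \<open>The inequality over \<open>\<theta>\<close> is the image under
      \<open>\<psi> \<eta>\<close> of the previous one over \<open>\<eta>\<close>, hence the
      induction over all base points at once.\<close>
    then obtain \<eta> where \<eta>: "\<eta> \<in> B" "\<theta> = R \<eta>"
      using bij by (auto simp: bij_betw_def)
    show ?case
      using mono_onD[OF bspec[OF mono \<eta>(1)] mem[OF \<eta>(1)] mem[OF \<eta>(1)] Suc.IH[OF \<eta>(1)]]
      by (simp add: \<eta> phi_seq_Suc[OF bij])
  qed
qed

lemma phi_seq_tendsto_phi_K:
  assumes "a > 0" "skew_product B a R \<psi>" "bij_betw R B B"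
    and "\<forall>\<theta>\<in>B. mono_on {0..a} (\<psi> \<theta>)" and "\<theta> \<in> B"
  shows "(\<lambda>n. phi_seq B a R \<psi> n \<theta>) \<longlonglongrightarrow> phi_K B a R \<psi> \<theta>"
proof -
  have "\<forall>n. 0 \<le> phi_seq B a R \<psi> n \<theta>"
    using phi_seq_mem[OF assms(1-3,5)] by simp
  then obtain L where "(\<lambda>n. phi_seq B a R \<psi> n \<theta>) \<longlonglongrightarrow> L"
    by (rule decseq_convergent[OF phi_seq_decseq[OF assms]])
  then show ?thesis
    unfolding phi_K_def by (simp add: limI)
qed

lemma phi_K_mem:
  assumes "a > 0" "skew_product B a R \<psi>" "bij_betw R B B"
    and "\<forall>\<theta>\<in>B. mono_on {0..a} (\<psi> \<theta>)" and "\<theta> \<in> B"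
  shows "phi_K B a R \<psi> \<theta> \<in> {0..a}"
  by (rule Lim_in_closed_set[OF closed_atLeastAtMost _ _ phi_seq_tendsto_phi_K[OF assms]])
    (use phi_seq_mem[OF assms(1-3,5)] in auto)

lemma invariant_graph_phi_K:
  assumes "a > 0" "skew_product B a R \<psi>" and bij: "bij_betw R B B"
    and "\<forall>\<theta>\<in>B. mono_on {0..a} (\<psi> \<theta>)"
    and cont: "\<forall>\<theta>\<in>B. continuous_on {0..a} (\<psi> \<theta>)"
  shows "invariant_graph B R \<psi> (phi_K B a R \<psi>)"
  unfolding invariant_graph_def
proof
  fix \<theta> assume \<theta>: "\<theta> \<in> B"
  then have R\<theta>: "R \<theta> \<in> B"
    using bij by (auto simp: bij_betw_def)
  have "(\<lambda>n. \<psi> \<theta> (phi_seq B a R \<psi> n \<theta>)) \<longlonglongrightarrow> \<psi> \<theta> (phi_K B a R \<psi> \<theta>)"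
    using phi_seq_mem[OF assms(1-3) \<theta>]
    by (intro continuous_on_tendsto_compose[OF bspec[OF cont \<theta>] phi_seq_tendsto_phi_K[OF assms(1-4) \<theta>]
          phi_K_mem[OF assms(1-4) \<theta>]]) auto
  \<comment> \<open>By the cocycle identity the same sequence is the one over
    \<open>R \<theta>\<close> without its first term.\<close>
  moreover have "(\<lambda>n. \<psi> \<theta> (phi_seq B a R \<psi> n \<theta>)) \<longlonglongrightarrow> phi_K B a R \<psi> (R \<theta>)"
    using LIMSEQ_Suc[OF phi_seq_tendsto_phi_K[OF assms(1-4) R\<theta>]]
    by (simp add: phi_seq_Suc[OF bij \<theta>])
  ultimately show "\<psi> \<theta> (phi_K B a R \<psi> \<theta>) = phi_K B a R \<psi> (R \<theta>)"
    by (rule LIMSEQ_unique)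
qed

lemma funpow_measurable:
  assumes "f \<in> measurable N N"
  shows "f ^^ n \<in> measurable N N"
  by (induction n) (auto intro: measurable_compose assms simp: id_def comp_def)

text \<open>The function is a composition of the section at height \<open>a\<close> over the
  \<open>n\<close>-th inverse iterate, the \<open>n\<close>-th iterate of the skew map, and the
  second projection.\<close>

lemma phi_seq_measurable:
  assumes "a > 0" "measurable_skew_product M a R \<psi>"
  shows "phi_seq (space M) a R \<psi> n \<in> borel_measurable M"
proof -
  let ?I = "restrict_space borel {0..a} :: real measure"
  have S: "the_inv_into (space M) R \<in> measurable M M"
    and F: "skew_map R \<psi> \<in> measurable (M \<Otimes>\<^sub>M ?I) (M \<Otimes>\<^sub>M ?I)"
    using assms(2) by (auto simp: measurable_skew_product_def)
  have "a \<in> space ?I"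
    using \<open>a > 0\<close> by (simp add: space_restrict_space)
  then have "(\<lambda>\<theta>. ((the_inv_into (space M) R ^^ n) \<theta>, a)) \<in> measurable M (M \<Otimes>\<^sub>M ?I)"
    by (intro measurable_Pair measurable_const funpow_measurable[OF S])
  from measurable_compose[OF this funpow_measurable[OF F]]
  have "(\<lambda>\<theta>. snd ((skew_map R \<psi> ^^ n) ((the_inv_into (space M) R ^^ n) \<theta>, a))) \<in> measurable M ?I"
    by (rule measurable_compose[OF _ measurable_snd])
  then have "phi_seq (space M) a R \<psi> n \<in> measurable M ?I"
    by (simp add: phi_seq_def[abs_def])
  then show ?thesis
    by (simp add: measurable_restrict_space2_iff)
qed

text \<open>Makes the zero set of the limit an event, so that ergodicity can be applied to
  it.\<close>

lemma phi_K_measurable: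
  assumes "a > 0" "measurable_skew_product M a R \<psi>"
  shows "phi_K (space M) a R \<psi> \<in> borel_measurable M"
  unfolding phi_K_def[abs_def]
  by (intro borel_measurable_lim_metric phi_seq_measurable assms)

theorem mainTheorem9:
  fixes M :: "'b measure" and R :: "'b \<Rightarrow> 'b"
    and \<psi> :: "'b \<Rightarrow> real \<Rightarrow> real" and a :: real
  assumes a_pos: "a > 0"
    and prob: "prob_space M"
    and equiconcave: "monotone_equiconcave (space M) a R \<psi>"
    and invertible: "bij_betw R (space M) (space M)"
    and ergodic: "ergodic_map M R"
  shows "(\<forall>\<theta>\<in>space M. decseq (\<lambda>n. phi_seq (space M) a R \<psi> n \<theta>)) \<and>
         (\<forall>\<theta>\<in>space M. convergent (\<lambda>n. phi_seq (space M) a R \<psi> n \<theta>)) \<and>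
         invariant_graph (space M) R \<psi> (phi_K (space M) a R \<psi>) \<and>
         invariant_set R {\<theta> \<in> space M. phi_K (space M) a R \<psi> \<theta> = 0} \<and>
         (measurable_skew_product M a R \<psi> \<longrightarrow>
            (AE \<theta> in M. phi_K (space M) a R \<psi> \<theta> = 0) \<or>
            (AE \<theta> in M. phi_K (space M) a R \<psi> \<theta> > 0))"
proof -
  let ?B = "space M"
  let ?\<phi> = "phi_K ?B a R \<psi>"
  let ?Z = "{\<theta> \<in> ?B. ?\<phi> \<theta> = 0}"
  interpret prob_space M by (rule prob)
  have sp: "skew_product ?B a R \<psi>" and zero: "\<And>\<theta>. \<theta> \<in> ?B \<Longrightarrow> \<psi> \<theta> 0 = 0"
    and mono: "\<forall>\<theta>\<in>?B. mono_on {0..a} (\<psi> \<theta>)"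
    and cont: "\<forall>\<theta>\<in>?B. continuous_on {0..a} (\<psi> \<theta>)"
    using equiconcave by (auto simp: monotone_equiconcave_def alpha_concave_on_def)
  note conv = phi_seq_tendsto_phi_K[OF a_pos sp invertible mono]
  have graph: "invariant_graph ?B R \<psi> ?\<phi>"
    by (rule invariant_graph_phi_K[OF a_pos sp invertible mono cont])
  \<comment> \<open>The zero section is fixed by the fibre maps, so the invariant graph cannot leave
    it once it is there.\<close>
  have "?\<phi> (R \<theta>) = 0" "R \<theta> \<in> ?B" if "\<theta> \<in> ?Z" for \<theta>
    using that graph zero sp by (force simp: invariant_graph_def skew_product_def)+
  then have Z_inv: "invariant_set R ?Z"
    by (auto simp: invariant_set_def)
  have dichotomy: "(AE \<theta> in M. ?\<phi> \<theta> = 0) \<or> (AE \<theta> in M. ?\<phi> \<theta> > 0)"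
    if "measurable_skew_product M a R \<psi>"
  proof -
    have [measurable]: "?\<phi> \<in> borel_measurable M"
      by (rule phi_K_measurable[OF a_pos that])
    have Z: "?Z \<in> sets M" by measurable
    from ergodic_forward_invariant[OF prob ergodic Z Z_inv] show ?thesis
    proof
      assume "prob ?Z = 0"
      then have "AE \<theta> in M. \<theta> \<notin> ?Z"
        using Z by (simp add: AE_iff_measurable[OF Z] emeasure_eq_measure)
      \<comment> \<open>Within the space, lying outside \<open>?Z\<close> means that the limit is
        nonzero; being in \<open>{0..a}\<close>, it is then positive.\<close>
      then have "AE \<theta> in M. ?\<phi> \<theta> > 0"
        using AE_space
      proof eventually_elim
        case (elim \<theta>)
        then show ?case
          using phi_K_mem[OF a_pos sp invertible mono, of \<theta>] by auto
      qed
      then show ?thesis ..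
    next
      assume "prob ?Z = 1"
      then have "AE \<theta> in M. \<theta> \<in> ?Z"
        by (simp add: prob_eq_1[OF Z])
      then have "AE \<theta> in M. ?\<phi> \<theta> = 0"
        by eventually_elim simp
      then show ?thesis ..
    qed
  qed
  show ?thesis
    using phi_seq_decseq[OF a_pos sp invertible mono] conv graph Z_inv dichotomy
    by (auto simp: convergent_def)
qed

end
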